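(* Let $N\ge 1$, let $-1=x_0<x_1<\cdots<x_N=1$ be a grid, and let $\mathcal S=\{s_1,\ldots,s_N\}$ be a family of $N$ pairwise distinct intervals $s_i=[x_{\ell_i},x_{r_i}]$ with integers $0\le \ell_i<r_i\le N$. Let $A_{\mathcal S}\in\mathbb R^{N\times N}$ be the associated interval matrix. If $A_{\mathcal S}$ is nonsingular, then $$A_{\mathcal S}^{-1}=B_{\mathcal S},$$ where $B_{\mathcal S}=[\varepsilon_{ji}]_{j,i=1}^N$ is the signed path matrix of the endpoint graph.
   Context: The interval matrix is $[A_{\mathcal S}]_{ij}=1$ if $\ell_i<j\le r_i$ and $0$ otherwise, $i,j=1,\ldots,N$. The endpoint graph $\mathcal G_{\mathcal S}$ is the undirected graph with vertex set $\{0,1,\ldots,N\}$ and edge set $\{\{\ell_i,r_i\}: i=1,\ldots,N\}$. When $A_{\mathcal S}$ is nonsingular, $\mathcal G_{\mathcal S}$ is connected with $N+1$ vertices and $N$ edges, hence a tree, so any two vertices are joined by a unique path (a sequence of pairwise distinct, consecutively adjacent vertices). For $j=1,\ldots,N$ let $\mathcal P_j$ be the unique path from $j-1$ to $j$. Define $\varepsilon_{ji}=1$ if $\mathcal P_j$ (traversed from $j-1$ to $j$) uses the edge of $s_i$ in the direction from $\ell_i$ to $r_i$; $\varepsilon_{ji}=-1$ if it uses this edge in the direction from $r_i$ to $\ell_i$; and $\varepsilon_{ji}=0$ if it does not use this edge. *)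

theory Defs
  imports
    Complex_Main
    "Jordan_Normal_Form.Matrix"
    "Graph_Theory.Pair_Digraph"
    "Graph_Theory.Vertex_Walk"
begin

text \<open>
  The \<open>i\<close>-th interval, \<open>1 \<le> i \<le> N\<close>, reaches from grid point \<open>l i\<close> to grid point \<open>r i\<close>.
  Intervals and grid cells are numbered from 1, whereas the entries of a matrix are
  numbered from 0; hence the shifts by \<open>Suc\<close> below.
\<close>

definition interval_matrix :: "nat \<Rightarrow> (nat \<Rightarrow> nat) \<Rightarrow> (nat \<Rightarrow> nat) \<Rightarrow> real mat" where
  "interval_matrix N l r =
     mat N N (\<lambda>(i, j). if l (Suc i) < Suc j \<and> Suc j \<le> r (Suc i) then 1 else 0)"

text \<open>As usual in \<open>Graph_Theory\<close>, an undirected edge is represented by its two orientations.\<close>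

definition endpoint_graph :: "nat \<Rightarrow> (nat \<Rightarrow> nat) \<Rightarrow> (nat \<Rightarrow> nat) \<Rightarrow> nat pair_pre_digraph" where
  "endpoint_graph N l r =
     \<lparr> pverts = {0..N}, parcs = {(u, v). \<exists>i\<in>{1..N}. {u, v} = {l i, r i}} \<rparr>"

text \<open>
  The description is meaningful only where exactly one such path exists, as in a tree.
\<close>

definition endpoint_path :: "nat \<Rightarrow> (nat \<Rightarrow> nat) \<Rightarrow> (nat \<Rightarrow> nat) \<Rightarrow> nat \<Rightarrow> nat vwalk" where
  "endpoint_path N l r j =
     (THE p. vpath p (with_proj (endpoint_graph N l r)) \<and> hd p = j - 1 \<and> last p = j)"

definition path_sign :: "nat \<Rightarrow> (nat \<Rightarrow> nat) \<Rightarrow> (nat \<Rightarrow> nat) \<Rightarrow> nat \<Rightarrow> nat \<Rightarrow> real" where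
  "path_sign N l r j i =
     (if (l i, r i) \<in> set (vwalk_arcs (endpoint_path N l r j)) then 1
      else if (r i, l i) \<in> set (vwalk_arcs (endpoint_path N l r j)) then - 1
      else 0)"

definition signed_path_matrix :: "nat \<Rightarrow> (nat \<Rightarrow> nat) \<Rightarrow> (nat \<Rightarrow> nat) \<Rightarrow> real mat" where
  "signed_path_matrix N l r = mat N N (\<lambda>(j, i). path_sign N l r (Suc j) (Suc i))"

end

theory Submission
  imports Defs "Jordan_Normal_Form.Determinant"
begin

text \<open>
  Row \<open>i\<close> of the interval matrix is a difference operator in disguise: applied to the increments
  \<open>f k - f (k - 1)\<close> of a function \<open>f\<close> on the vertices \<open>0, \<dots>, N\<close>, it telescopes to
  \<open>f (r i) - f (l i)\<close>, the increment of \<open>f\<close> along the edge of the \<open>i\<close>-th interval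
  (\<open>interval_row_telescope\<close>). Three consequences of this carry the proof.

  A left inverse: increments also telescope along a path, so the signed sum of the edge increments
  over a path from \<open>j - 1\<close> to \<open>j\<close> is \<open>f j - f (j - 1)\<close> (\<open>path_telescope\<close>). Taking for \<open>f\<close> the
  indicator of \<open>{k..}\<close> turns edge increments into entries of the interval matrix and this
  difference into the Kronecker delta. So the signs of any path from \<open>j - 1\<close> to \<open>j\<close> form
  a row vector that the matrix sends to the \<open>j\<close>-th unit vector (\<open>path_row\<close>).

  Uniqueness of the path: a nonsingular matrix admits only one such row vector, so any two paths
  have the same signs, hence the same arcs, and a path is determined by its first vertex
  and its arcs (\<open>path_unique\<close>).

  Existence of the path: the indicator of the connected component of \<open>j - 1\<close> is constant along
  every edge, so its increments lie in the kernel of the matrix and vanish. Hence \<open>j\<close> lies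
  in that component (\<open>path_exists\<close>).

  The paths in the definition of the signed path matrix are thus well defined, and this matrix is a
  left inverse; for square matrices over a field it is then a two-sided one.
\<close>

section \<open>Signs and increments along vertex paths\<close>

text \<open>
  The signs of an arbitrary vertex path, so that two candidates for the path from \<open>j - 1\<close> to \<open>j\<close>
  can be compared before it is known that there is exactly one.
\<close>

definition arc_sign :: "'a vwalk \<Rightarrow> 'a \<Rightarrow> 'a \<Rightarrow> real" where
  "arc_sign p u v =
     (if (u, v) \<in> set (vwalk_arcs p) then 1
      else if (v, u) \<in> set (vwalk_arcs p) then - 1 else 0)"

lemma arc_sign_Cons:
  assumes "a \<notin> set p" "p \<noteq> []" "u \<noteq> v"
  shows "arc_sign (a # p) u v =
    arc_sign p u v + (if (u, v) = (a, hd p) then 1 else 0) - (if (v, u) = (a, hd p) then 1 else 0)"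
proof -
  have old: "(a, w) \<notin> set (vwalk_arcs p)" "(w, a) \<notin> set (vwalk_arcs p)" for w
    using assms(1) by (auto dest: arcs_in_vwalk_arcs)
  have arcs: "set (vwalk_arcs (a # p)) = insert (a, hd p) (set (vwalk_arcs p))"
    using assms(2) by simp
  consider "u = a" "v = hd p" | "v = a" "u = hd p"
    | "(u, v) \<noteq> (a, hd p)" "(v, u) \<noteq> (a, hd p)" by auto
  then show ?thesis
  proof cases
    case 1
    then show ?thesis using assms(3) old unfolding arc_sign_def arcs by simp
  next
    case 2
    then show ?thesis using assms(3) old unfolding arc_sign_def arcs by simp
  next
    case 3
    then show ?thesis
      unfolding arc_sign_def arcs by (simp only: insert_iff if_False simp_thms add_0_right diff_0_right)
  qed
qed

lemma vwalk_arcs_asym: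
  assumes "distinct p" "(u, v) \<in> set (vwalk_arcs p)"
  shows "(v, u) \<notin> set (vwalk_arcs p)"
  using assms by (induction p rule: vwalk_arcs.induct) (auto dest: arcs_in_vwalk_arcs)

lemma arc_sign_eq_1_iff: "arc_sign p u v = 1 \<longleftrightarrow> (u, v) \<in> set (vwalk_arcs p)"
  by (simp add: arc_sign_def)

lemma arc_sign_eq_minus_1_iff:
  assumes "distinct p"
  shows "arc_sign p u v = - 1 \<longleftrightarrow> (v, u) \<in> set (vwalk_arcs p)"
  using vwalk_arcs_asym[OF assms] by (auto simp: arc_sign_def)

text \<open>
  The first vertex of a path lies on no later arc, so it is the tail of exactly one arc; this
  arc gives the second vertex, and removing it leaves the arcs of the remaining path.
\<close>

lemma distinct_vwalk_arcs_inj: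
  assumes "distinct p" "distinct q" "p \<noteq> []" "q \<noteq> []" "hd p = hd q"
    and "set (vwalk_arcs p) = set (vwalk_arcs q)"
  shows "p = q"
  using assms
proof (induction p arbitrary: q rule: vwalk_arcs.induct)
  case (2 x)
  then show ?case by (cases q rule: vwalk_arcs.cases) auto
next
  case (3 x y ys)
  then obtain z zs where q: "q = x # z # zs"
    by (cases q rule: vwalk_arcs.cases) auto
  have notin: "(x, b) \<notin> set (vwalk_arcs (y # ys))" "(x, b) \<notin> set (vwalk_arcs (z # zs))" for b
    using 3 q by (auto dest: arcs_in_vwalk_arcs)
  have arcs: "insert (x, y) (set (vwalk_arcs (y # ys))) = insert (x, z) (set (vwalk_arcs (z # zs)))"
    using 3 q by simp
  then have "y = z" using notin by blast
  then have "set (vwalk_arcs (y # ys)) = set (vwalk_arcs (z # zs))"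
    using arcs notin[of z] by (simp add: insert_ident)
  then have "y # ys = z # zs"
    using 3 q \<open>y = z\<close> by (intro "3.IH") auto
  then show ?case by (simp add: q)
qed simp

text \<open>
  Prepending a vertex to the path adds one arc. It belongs to exactly one edge, which the
  old path did not use, so the signed sum changes by the increment of \<open>f\<close> along this arc.
\<close>

lemma path_telescope:
  fixes f :: "'a \<Rightarrow> real"
  assumes "finite I" "inj_on (\<lambda>i. {l i, r i}) I" "\<And>i. i \<in> I \<Longrightarrow> l i \<noteq> r i"
    and "distinct p" "p \<noteq> []"
    and "\<And>u v. (u, v) \<in> set (vwalk_arcs p) \<Longrightarrow> \<exists>i\<in>I. {u, v} = {l i, r i}"
  shows "(\<Sum>i\<in>I. arc_sign p (l i) (r i) * (f (r i) - f (l i))) = f (last p) - f (hd p)"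
  using assms(4-)
proof (induction p rule: vwalk_arcs.induct)
  case (2 x)
  then show ?case by (simp add: arc_sign_def)
next
  case (3 x y ys)
  let ?p = "y # ys"
  let ?new = "\<lambda>i. (if (l i, r i) = (x, y) then 1 else 0) - (if (r i, l i) = (x, y) then 1 else 0 :: real)"
  obtain m where m: "m \<in> I" "{x, y} = {l m, r m}"
    using "3.prems"(3)[of x y] by auto
  have new0: "?new i = 0" if "i \<in> I - {m}" for i
  proof -
    have "{l i, r i} \<noteq> {x, y}"
      using inj_onD[OF assms(2), of i m] m that by (metis DiffD1 DiffD2 singletonI)
    then have "(l i, r i) \<noteq> (x, y)" "(r i, l i) \<noteq> (x, y)"
      by auto
    then show ?thesis by (simp only: if_False diff_self)
  qed
  have newm: "?new m * (f (r m) - f (l m)) = f y - f x"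
  proof -
    have "l m \<noteq> r m" using m assms(3) by blast
    moreover have "x = l m \<and> y = r m \<or> x = r m \<and> y = l m"
      using m(2) unfolding doubleton_eq_iff .
    ultimately show ?thesis by (elim disjE conjE; hypsubst; simp)
  qed
  have "(\<Sum>i\<in>I. ?new i * (f (r i) - f (l i))) = (\<Sum>i\<in>{m}. ?new i * (f (r i) - f (l i)))"
    using assms(1) m new0 by (intro sum.mono_neutral_right) auto
  then have new: "(\<Sum>i\<in>I. ?new i * (f (r i) - f (l i))) = f y - f x"
    using newm by simp
  have "(\<Sum>i\<in>I. arc_sign (x # ?p) (l i) (r i) * (f (r i) - f (l i))) =
        (\<Sum>i\<in>I. arc_sign ?p (l i) (r i) * (f (r i) - f (l i)) + ?new i * (f (r i) - f (l i)))"
  proof (intro sum.cong refl)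
    fix i assume "i \<in> I"
    then have "arc_sign (x # ?p) (l i) (r i) = arc_sign ?p (l i) (r i) + ?new i"
      using arc_sign_Cons[of x ?p "l i" "r i"] "3.prems"(1) assms(3) by simp
    then show "arc_sign (x # ?p) (l i) (r i) * (f (r i) - f (l i)) =
        arc_sign ?p (l i) (r i) * (f (r i) - f (l i)) + ?new i * (f (r i) - f (l i))"
      by (simp only: distrib_right)
  qed
  also have "\<dots> = (f (last ?p) - f y) + (f y - f x)"
    unfolding sum.distrib new using 3 by simp
  finally show ?case by simp
qed simp

section \<open>The interval matrix as a difference operator\<close>

lemma interval_matrix_carrier: "interval_matrix N l r \<in> carrier_mat N N"
  by (simp add: interval_matrix_def)

lemma signed_path_matrix_carrier: "signed_path_matrix N l r \<in> carrier_mat N N"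
  by (simp add: signed_path_matrix_def)

text \<open>
  The ones of the row are exactly the cells between its two endpoints, so the product adds up
  consecutive increments of \<open>f\<close> from one endpoint to the other.
\<close>

lemma interval_row_telescope:
  fixes f :: "nat \<Rightarrow> real"
  assumes "i < N" "l (Suc i) \<le> r (Suc i)" "r (Suc i) \<le> N"
  shows "(interval_matrix N l r *\<^sub>v vec N (\<lambda>k. f (Suc k) - f k)) $ i
       = f (r (Suc i)) - f (l (Suc i))"
proof -
  have "(interval_matrix N l r *\<^sub>v vec N (\<lambda>k. f (Suc k) - f k)) $ i =
      (\<Sum>k = 0..<N. (if l (Suc i) < Suc k \<and> Suc k \<le> r (Suc i) then 1 else 0) * (f (Suc k) - f k))"
    using assms by (simp add: interval_matrix_def scalar_prod_def)
  also have "\<dots> = (\<Sum>k = l (Suc i)..<r (Suc i). f (Suc k) - f k)"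
    using assms by (intro sum.mono_neutral_cong_right) auto
  also have "\<dots> = f (r (Suc i)) - f (l (Suc i))"
    using assms by (intro sum_Suc_diff') auto
  finally show ?thesis .
qed

text \<open>The indicator of \<open>{Suc k..}\<close> has its only nonzero increment, 1, in cell \<open>Suc k\<close>.\<close>

lemma interval_matrix_entry:
  assumes "i < N" "k < N" "l (Suc i) \<le> r (Suc i)"
  shows "interval_matrix N l r $$ (i, k) =
    of_bool (Suc k \<le> r (Suc i)) - of_bool (Suc k \<le> l (Suc i))"
  using assms by (simp add: interval_matrix_def)

lemma invertible_mat_inverseE:
  assumes "A \<in> carrier_mat n n" "invertible_mat A"
  obtains B where "B \<in> carrier_mat n n" "A * B = 1\<^sub>m n" "B * A = 1\<^sub>m n"
proof -
  obtain B where B: "A * B = 1\<^sub>m (dim_row A)" "B * A = 1\<^sub>m (dim_row B)"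
    using assms(2) unfolding invertible_mat_def inverts_mat_def by blast
  have "dim_col B = n"
    using arg_cong[OF B(1), of dim_col] assms(1) by simp
  moreover have row: "dim_row B = n"
    using arg_cong[OF B(2), of dim_col] assms(1) by simp
  ultimately have "B \<in> carrier_mat n n"
    by (intro carrier_matI)
  moreover have "A * B = 1\<^sub>m n" "B * A = 1\<^sub>m n"
    using B row assms(1) by (simp_all only: carrier_matD(1))
  ultimately show thesis by (rule that)
qed

lemma invertible_mat_mult_vec_inj:
  fixes A :: "'a :: comm_ring_1 mat"
  assumes "A \<in> carrier_mat n n" "invertible_mat A" "v \<in> carrier_vec n" "w \<in> carrier_vec n"
    and "A *\<^sub>v v = A *\<^sub>v w"
  shows "v = w"
proof -
  obtain B where B: "B \<in> carrier_mat n n" "B * A = 1\<^sub>m n"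
    using assms by (auto elim: invertible_mat_inverseE)
  have "v = B *\<^sub>v (A *\<^sub>v v)"
    using assms(3) B assoc_mult_mat_vec[OF B(1) assms(1,3)] by simp
  also have "\<dots> = B *\<^sub>v (A *\<^sub>v w)"
    by (simp only: assms(5))
  also have "\<dots> = w"
    using assms(4) B assoc_mult_mat_vec[OF B(1) assms(1,4)] by simp
  finally show ?thesis .
qed

lemma invertible_mat_transpose:
  fixes A :: "'a :: comm_ring_1 mat"
  assumes "A \<in> carrier_mat n n" "invertible_mat A"
  shows "invertible_mat (transpose_mat A)"
proof -
  obtain B where B: "B \<in> carrier_mat n n" "A * B = 1\<^sub>m n" "B * A = 1\<^sub>m n"
    using assms by (auto elim: invertible_mat_inverseE)
  have "transpose_mat A * transpose_mat B = 1\<^sub>m n"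
    unfolding transpose_mult[OF B(1) assms(1), symmetric] B(3) by (rule transpose_one)
  moreover have "transpose_mat B * transpose_mat A = 1\<^sub>m n"
    unfolding transpose_mult[OF assms(1) B(1), symmetric] B(2) by (rule transpose_one)
  moreover have "dim_row (transpose_mat A) = n" "dim_col (transpose_mat A) = n"
    "dim_row (transpose_mat B) = n"
    using assms(1) B(1) by simp_all
  ultimately show ?thesis
    unfolding invertible_mat_def inverts_mat_def square_mat.simps by metis
qed

section \<open>Paths in the endpoint graph\<close>

locale interval_family =
  fixes N :: nat and l r :: "nat \<Rightarrow> nat"
  assumes endpoints: "i \<in> {1..N} \<Longrightarrow> l i < r i \<and> r i \<le> N"
    and endpoints_inj: "inj_on (\<lambda>i. (l i, r i)) {1..N}"
    and nonsingular: "invertible_mat (interval_matrix N l r)"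
begin

abbreviation G where "G \<equiv> endpoint_graph N l r"

text \<open>The left endpoint is the smaller one, so an interval is determined by its undirected edge.\<close>

lemma edges_inj: "inj_on (\<lambda>i. {l i, r i}) {1..N}"
proof (rule inj_onI)
  fix i i' assume i: "i \<in> {1..N}" "i' \<in> {1..N}" "{l i, r i} = {l i', r i'}"
  then have "(l i, r i) = (l i', r i')"
    using endpoints[of i] endpoints[of i'] by (auto simp: doubleton_eq_iff)
  then show "i = i'" using inj_onD[OF endpoints_inj] i by blast
qed

lemma vpath_arcs_edges:
  assumes "vpath p (with_proj G)" "(u, v) \<in> set (vwalk_arcs p)"
  shows "\<exists>i\<in>{1..N}. {u, v} = {l i, r i}"
  using assms by (auto simp: vpath_def vwalk_def endpoint_graph_def)

text \<open>
  Column \<open>k\<close> of the interval matrix, counted from 0, lists the edge increments of the indicator of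
  \<open>{Suc k..}\<close>, which along the whole path increases by 1 if \<open>j = k\<close> and not at all otherwise.
  The row vector is written as a vector multiplied by the transposed matrix.
\<close>

lemma path_row:
  assumes p: "vpath p (with_proj G)" "hd p = j" "last p = Suc j" and "j < N"
  shows "transpose_mat (interval_matrix N l r) *\<^sub>v vec N (\<lambda>i. arc_sign p (l (Suc i)) (r (Suc i)))
       = unit_vec N j"
proof (rule eq_vecI)
  fix k assume "k < dim_vec (unit_vec N j :: real vec)"
  then have k: "k < N" by simp
  define f :: "nat \<Rightarrow> real" where "f v = of_bool (Suc k \<le> v)" for v
  have "(transpose_mat (interval_matrix N l r) *\<^sub>v
          vec N (\<lambda>i. arc_sign p (l (Suc i)) (r (Suc i)))) $ k =
        (\<Sum>i = 0..<N. interval_matrix N l r $$ (i, k) * arc_sign p (l (Suc i)) (r (Suc i)))"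
    using k interval_matrix_carrier[of N l r] by (simp add: scalar_prod_def)
  also have "\<dots> = (\<Sum>i = 0..<N. arc_sign p (l (Suc i)) (r (Suc i)) * (f (r (Suc i)) - f (l (Suc i))))"
  proof (intro sum.cong refl)
    fix i assume "i \<in> {0..<N}"
    then show "interval_matrix N l r $$ (i, k) * arc_sign p (l (Suc i)) (r (Suc i)) =
        arc_sign p (l (Suc i)) (r (Suc i)) * (f (r (Suc i)) - f (l (Suc i)))"
      using k endpoints[of "Suc i"] by (simp add: interval_matrix_entry f_def)
  qed
  also have "\<dots> = (\<Sum>i\<in>{1..N}. arc_sign p (l i) (r i) * (f (r i) - f (l i)))"
    by (rule sum.reindex_bij_witness[of _ "\<lambda>i. i - 1" Suc]) auto
  also have "\<dots> = f (last p) - f (hd p)"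
    using p endpoints
    by (intro path_telescope edges_inj vpath_arcs_edges) (fastforce simp: vpath_def vwalk_def)+
  also have "\<dots> = unit_vec N j $ k"
    using p k \<open>j < N\<close> by (auto simp: f_def)
  finally show "(transpose_mat (interval_matrix N l r) *\<^sub>v
      vec N (\<lambda>i. arc_sign p (l (Suc i)) (r (Suc i)))) $ k = unit_vec N j $ k" .
qed (simp add: interval_matrix_def)

text \<open>
  The signs of both paths solve the same nonsingular linear system, so they agree. The sign of
  an edge tells which of its two arcs, if any, the path uses, because a path never uses both.
\<close>

lemma path_unique:
  assumes p: "vpath p (with_proj G)" "hd p = j" "last p = Suc j"
    and q: "vpath q (with_proj G)" "hd q = j" "last q = Suc j" and j: "j < N"
  shows "p = q"
proof -
  let ?sign = "\<lambda>p. vec N (\<lambda>i. arc_sign p (l (Suc i)) (r (Suc i)))"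
  have "transpose_mat (interval_matrix N l r) *\<^sub>v ?sign p =
      transpose_mat (interval_matrix N l r) *\<^sub>v ?sign q"
    by (simp only: path_row[OF p j] path_row[OF q j])
  with transpose_carrier_mat[THEN iffD2, OF interval_matrix_carrier]
    invertible_mat_transpose[OF interval_matrix_carrier nonsingular] vec_carrier vec_carrier
  have "?sign p = ?sign q"
    by (rule invertible_mat_mult_vec_inj)
  then have shifted: "?sign p $ k = ?sign q $ k" for k
    by simp
  have signs: "arc_sign p (l i) (r i) = arc_sign q (l i) (r i)" if "i \<in> {1..N}" for i
    using shifted[of "i - 1"] that by (cases i) simp_all
  have dist: "distinct p" "distinct q" "p \<noteq> []" "q \<noteq> []"
    using p q by (auto simp: vpath_def vwalk_def)
  have "(u, v) \<in> set (vwalk_arcs p) \<longleftrightarrow> (u, v) \<in> set (vwalk_arcs q)"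
    if "\<exists>i\<in>{1..N}. {u, v} = {l i, r i}" for u v
  proof -
    obtain i where "i \<in> {1..N}" and "u = l i \<and> v = r i \<or> u = r i \<and> v = l i"
      using \<open>\<exists>i\<in>{1..N}. {u, v} = {l i, r i}\<close> unfolding doubleton_eq_iff by blast
    then show ?thesis
      using signs[of i] dist arc_sign_eq_1_iff arc_sign_eq_minus_1_iff by metis
  qed
  then have "(u, v) \<in> set (vwalk_arcs p) \<longleftrightarrow> (u, v) \<in> set (vwalk_arcs q)" for u v
    using vpath_arcs_edges[OF p(1)] vpath_arcs_edges[OF q(1)] by metis
  then have "set (vwalk_arcs p) = set (vwalk_arcs q)"
    by auto
  then show ?thesis
    using distinct_vwalk_arcs_inj dist p q by metis
qed

text \<open>
  If \<open>j\<close> and \<open>Suc j\<close> lay in different components, the indicator of the component of \<open>j\<close>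
  would have a nonzero vector of increments, although its increment along every edge is zero.
\<close>

lemma path_exists:
  assumes j: "j < N"
  shows "\<exists>p. vpath p (with_proj G) \<and> hd p = j \<and> last p = Suc j"
proof -
  interpret pair_wf_digraph G
    using endpoints by unfold_locales (force simp: endpoint_graph_def doubleton_eq_iff)+
  let ?f = "\<lambda>v. of_bool (j \<rightarrow>\<^sup>*\<^bsub>with_proj G\<^esub> v) :: real"
  have edge: "(l i, r i) \<in> parcs G" "(r i, l i) \<in> parcs G" if "i \<in> {1..N}" for i
    using that by (auto simp: endpoint_graph_def)
  have const: "?f (r i) = ?f (l i)" if "i \<in> {1..N}" for i
    using edge[OF that] reachable_adj_trans[of j "l i" "r i"] reachable_adj_trans[of j "r i" "l i"]
    by auto
  have "interval_matrix N l r *\<^sub>v vec N (\<lambda>k. ?f (Suc k) - ?f k) = 0\<^sub>v N"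
  proof (rule eq_vecI)
    fix i assume "i < dim_vec (0\<^sub>v N :: real vec)"
    then have "i < N" by simp
    moreover from this have "l (Suc i) \<le> r (Suc i)" "r (Suc i) \<le> N" "?f (r (Suc i)) = ?f (l (Suc i))"
      using endpoints[of "Suc i"] const[of "Suc i"] by auto
    ultimately show "(interval_matrix N l r *\<^sub>v vec N (\<lambda>k. ?f (Suc k) - ?f k)) $ i = 0\<^sub>v N $ i"
      using interval_row_telescope[of i N l r ?f] by simp
  qed (simp add: interval_matrix_def)
  also have "0\<^sub>v N = interval_matrix N l r *\<^sub>v 0\<^sub>v N"
    using interval_matrix_carrier by (intro eq_vecI) (auto simp: interval_matrix_def scalar_prod_def)
  finally have "interval_matrix N l r *\<^sub>v vec N (\<lambda>k. ?f (Suc k) - ?f k) =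
      interval_matrix N l r *\<^sub>v 0\<^sub>v N" .
  with interval_matrix_carrier nonsingular vec_carrier zero_carrier_vec
  have "vec N (\<lambda>k. ?f (Suc k) - ?f k) = 0\<^sub>v N"
    by (rule invertible_mat_mult_vec_inj)
  then have "vec N (\<lambda>k. ?f (Suc k) - ?f k) $ j = 0\<^sub>v N $ j"
    by simp
  then have "?f (Suc j) = ?f j"
    using j by simp
  moreover have "j \<rightarrow>\<^sup>*\<^bsub>with_proj G\<^esub> j"
    using j by (intro reachable_refl) (simp add: endpoint_graph_def)
  ultimately have "j \<rightarrow>\<^sup>*\<^bsub>with_proj G\<^esub> Suc j"
    by simp
  then show ?thesis
    by (simp only: reachable_vpath_conv)
qed

lemma endpoint_path:
  assumes "j < N"
  shows "vpath (endpoint_path N l r (Suc j)) (with_proj G)"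
    and "hd (endpoint_path N l r (Suc j)) = j"
    and "last (endpoint_path N l r (Suc j)) = Suc j"
proof -
  have "\<exists>!p. vpath p (with_proj G) \<and> hd p = Suc j - 1 \<and> last p = Suc j"
    using path_exists[OF assms] path_unique assms by (auto intro: ex_ex1I)
  from theI'[OF this] show "vpath (endpoint_path N l r (Suc j)) (with_proj G)"
    "hd (endpoint_path N l r (Suc j)) = j" "last (endpoint_path N l r (Suc j)) = Suc j"
    by (auto simp: endpoint_path_def)
qed

lemma signed_path_matrix_left_inverse:
  "signed_path_matrix N l r * interval_matrix N l r = 1\<^sub>m N"
proof (rule eq_matI)
  fix j k assume "j < dim_row (1\<^sub>m N :: real mat)" "k < dim_col (1\<^sub>m N :: real mat)"
  then have jk: "j < N" "k < N" by auto
  let ?w = "vec N (\<lambda>i. arc_sign (endpoint_path N l r (Suc j)) (l (Suc i)) (r (Suc i)))"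
  have "row (signed_path_matrix N l r) j = ?w"
    using jk by (auto simp: signed_path_matrix_def path_sign_def arc_sign_def)
  then have "(signed_path_matrix N l r * interval_matrix N l r) $$ (j, k)
      = ?w \<bullet> col (interval_matrix N l r) k"
    using jk by (simp add: signed_path_matrix_def interval_matrix_def)
  also have "\<dots> = (transpose_mat (interval_matrix N l r) *\<^sub>v ?w) $ k"
    using jk interval_matrix_carrier[of N l r]
    by (subst comm_scalar_prod[of _ N]) (auto simp: interval_matrix_def)
  also have "\<dots> = 1\<^sub>m N $$ (j, k)"
    using path_row[OF endpoint_path[OF jk(1)] jk(1)] jk by auto
  finally show "(signed_path_matrix N l r * interval_matrix N l r) $$ (j, k) = 1\<^sub>m N $$ (j, k)" .
qed (simp_all add: signed_path_matrix_def interval_matrix_def)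

end

theorem theorem2:
  fixes N :: nat and x :: "nat \<Rightarrow> real" and l r :: "nat \<Rightarrow> nat"
  assumes "N \<ge> 1"
    and "x 0 = - 1" and "x N = 1" and "strict_mono_on {0..N} x"
    and "\<And>i. i \<in> {1..N} \<Longrightarrow> l i < r i \<and> r i \<le> N"
    and "inj_on (\<lambda>i. {x (l i)..x (r i)}) {1..N}"
    and "invertible_mat (interval_matrix N l r)"
  shows "inverts_mat (interval_matrix N l r) (signed_path_matrix N l r) \<and>
         inverts_mat (signed_path_matrix N l r) (interval_matrix N l r)"
proof -
  have "inj_on (\<lambda>i. (l i, r i)) {1..N}"
  proof (rule inj_onI)
    fix i i' assume i: "i \<in> {1..N}" "i' \<in> {1..N}" "(l i, r i) = (l i', r i')"
    then have "{x (l i)..x (r i)} = {x (l i')..x (r i')}"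
      by (simp only: prod.inject)
    then show "i = i'"
      using inj_onD[OF assms(6)] i by blast
  qed
  then interpret interval_family N l r
    using assms by unfold_locales auto
  have "interval_matrix N l r * signed_path_matrix N l r = 1\<^sub>m N"
    using mat_mult_left_right_inverse[OF signed_path_matrix_carrier interval_matrix_carrier
        signed_path_matrix_left_inverse] .
  then show ?thesis
    using signed_path_matrix_left_inverse interval_matrix_carrier[of N l r]
      signed_path_matrix_carrier[of N l r]
    by (simp add: inverts_mat_def)
qed

end
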